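(* Let $G$ be a countable sofic group and $(G_n)$ a chain of $G$. Then the profinite action of $G$ on $\partial T (G, (G_n))$ is $h$-expansive. Furthermore, if the boundary $\partial T (G, (G_n))$ of $T (G, (G_n))$ is infinite then the action is not expansive.
   Context: Profinite actions: a chain of $G$ is a sequence $G=G_0\ge G_1\ge\cdots$ of subgroups of finite index in $G$. The tree $T(G,(G_n))$ has vertices $\{gG_n:n\ge 0,\ g\in G\}$ (arranged by levels $n$), and $(g_1G_n,g_2G_m)$ is an edge if $m=n+1$ and $g_2G_m\subset g_1G_n$. The boundary $\partial T(G,(G_n))$ consists of all sequences $(x_0,x_1,\dots)$ of vertices, $x_n\in G/G_n$, with $x_n$ adjacent to $x_{n+1}$ for each $n\ge0$. It is a compact metrizable space with the topology generated by the basis of sets $O_x=\{(x_0,x_1,\dots)\in\partial T(G,(G_n)):x_N=x\}$, $x\in G/G_N$, $N\ge0$. The left actions of $G$ on the $G/G_n$ induce an action of $G$ on $\partial T(G,(G_n))$ by homeomorphisms, called the profinite action. Sofic setting: $G$ is a countable discrete sofic group with a fixed sofic approximation $\Sigma=\{\sigma_i: G \rightarrow \mathrm{Sym}(d_i),\ g\mapsto \sigma_{i, g}\}_{i\in \mathbb{N}}$, where $d_i\in\mathbb{N}$, $d_i\to\infty$, $\mathrm{Sym}(d)$ is the permutation group of $\{1,\dots,d\}$, and $\lim_{i} \frac{1}{d_i} |\{a: \sigma_{i,s}\sigma_{i,t}(a)=\sigma_{i,st}(a)\}|=1$ for all $s,t\in G$, $\lim_{i} \frac{1}{d_i} |\{a: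 \sigma_{i,s}(a)\neq \sigma_{i,t}(a)\}|=1$ for all distinct $s,t\in G$. Let $G$ act continuously on a compact metric space $(X,\rho)$ (here $X=\partial T(G,(G_n))$ with a compatible metric $\rho$). $(X,G)$ is expansive if there is $\delta>0$ such that for any two different points $x_1,x_2\in X$ there is $g\in G$ with $\rho(gx_1,gx_2)>\delta$. $\mathcal{C}_X$ and $\mathcal{C}_X^o$ are the sets of finite Borel covers and of finite open covers of $X$. For a cover $\mathcal{V}$ and a set $K$, $N(\mathcal{V},K)$ is the minimal cardinality of sub-families of $\mathcal{V}$ covering $K$ ($N(\mathcal{V},\emptyset)=0$). For $\mathcal{U}\in\mathcal{C}_X$, $\mathcal{U}^d$ is the cover of $X^d$ consisting of all products $U_1\times\cdots\times U_d$ with $U_j\in\mathcal{U}$. Convention: $\log 0=-\infty$. $\mathfrak{F}_G$ is the set of non-empty finite subsets of $G$. For $F\in\mathfrak{F}_G$, $\delta>0$, $\sigma:G\to\mathrm{Sym}(d)$, put $$X^d_{F,\delta,\sigma}=\left\{(x_1,\dots,x_d)\in X^d:\max_{s\in F}\sqrt{\sum_{j=1}^d\frac1d\rho^2(sx_j,x_{\sigma_s(j)})}<\delta\right\}.$$ For $\mathcal{U}_1,\mathcal{U}_2\in\mathcal{C}_X$ define $$h(G,\mathcal{U}_1|\mathcal{U}_2)=\inf_{F\in\mathfrak{F}_G}\inf_{\delta>0}\limsup_{i\to\infty}\frac1{d_i}\log\max_{V\in\mathcal{U}_2^{d_i}}N\left(\mathcal{U}_1^{d_i},X^{d_i}_{F,\delta,\sigma_i}\cap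 V\right)$$ and $h(G,X|\mathcal{U}_2)=\sup_{\mathcal{U}_1\in\mathcal{C}_X^o}h(G,\mathcal{U}_1|\mathcal{U}_2)$. $(X,G)$ is $h$-expansive if $h(G,X|\mathcal{U})\le0$ for some $\mathcal{U}\in\mathcal{C}_X^o$. *)

theory Defs
  imports "HOL-Analysis.Analysis" "HOL-Algebra.Left_Coset"
begin

definition group_chain :: "('g, 'b) monoid_scheme \<Rightarrow> (nat \<Rightarrow> 'g set) \<Rightarrow> bool" where
  "group_chain G H \<longleftrightarrow>
     H 0 = carrier G \<and>
     (\<forall>n. subgroup (H n) G \<and> finite (lcosets\<^bsub>G\<^esub> (H n)) \<and> H (Suc n) \<subseteq> H n)"

text \<open>Vertices carry their level, so that cosets of \<open>H n\<close> and of \<open>H m\<close> that coincide as sets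
  are still distinct vertices when \<open>n \<noteq> m\<close>.\<close>

definition tree_vertices :: "('g, 'b) monoid_scheme \<Rightarrow> (nat \<Rightarrow> 'g set) \<Rightarrow> (nat \<times> 'g set) set" where
  "tree_vertices G H = {(n, C) |n C. C \<in> lcosets\<^bsub>G\<^esub> (H n)}"

definition tree_edges ::
    "('g, 'b) monoid_scheme \<Rightarrow> (nat \<Rightarrow> 'g set) \<Rightarrow> ((nat \<times> 'g set) \<times> (nat \<times> 'g set)) set" where
  "tree_edges G H =
     {((n, C), (m, D)) |n C m D.
        (n, C) \<in> tree_vertices G H \<and> (m, D) \<in> tree_vertices G H \<and> m = Suc n \<and> D \<subseteq> C}"

text \<open>A boundary point is a sequence of cosets; the level of the \<open>n\<close>-th entry is \<open>n\<close>.\<close>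

definition tree_boundary :: "('g, 'b) monoid_scheme \<Rightarrow> (nat \<Rightarrow> 'g set) \<Rightarrow> (nat \<Rightarrow> 'g set) set" where
  "tree_boundary G H =
     {x. (\<forall>n. (n, x n) \<in> tree_vertices G H) \<and>
         (\<forall>n. ((n, x n), (Suc n, x (Suc n))) \<in> tree_edges G H)}"

definition boundary_cylinder ::
    "('g, 'b) monoid_scheme \<Rightarrow> (nat \<Rightarrow> 'g set) \<Rightarrow> nat \<Rightarrow> 'g set \<Rightarrow> (nat \<Rightarrow> 'g set) set" where
  "boundary_cylinder G H N C = {x \<in> tree_boundary G H. x N = C}"

definition boundary_topology ::
    "('g, 'b) monoid_scheme \<Rightarrow> (nat \<Rightarrow> 'g set) \<Rightarrow> (nat \<Rightarrow> 'g set) topology" where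
  "boundary_topology G H =
     topology_generated_by {boundary_cylinder G H N C |N C. C \<in> lcosets\<^bsub>G\<^esub> (H N)}"

definition profinite_action ::
    "('g, 'b) monoid_scheme \<Rightarrow> 'g \<Rightarrow> (nat \<Rightarrow> 'g set) \<Rightarrow> (nat \<Rightarrow> 'g set)" where
  "profinite_action G g x = (\<lambda>n. g <#\<^bsub>G\<^esub> x n)"

definition sofic_approximation ::
    "('g, 'b) monoid_scheme \<Rightarrow> (nat \<Rightarrow> nat) \<Rightarrow> (nat \<Rightarrow> 'g \<Rightarrow> nat \<Rightarrow> nat) \<Rightarrow> bool" where
  "sofic_approximation G d \<sigma> \<longleftrightarrow>
     filterlim d at_top sequentially \<and>
     (\<forall>i. \<forall>g\<in>carrier G. \<sigma> i g permutes {1..d i}) \<and>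
     (\<forall>s\<in>carrier G. \<forall>t\<in>carrier G.
        (\<lambda>i. real (card {a \<in> {1..d i}. \<sigma> i s (\<sigma> i t a) = \<sigma> i (s \<otimes>\<^bsub>G\<^esub> t) a}) / real (d i))
          \<longlonglongrightarrow> 1) \<and>
     (\<forall>s\<in>carrier G. \<forall>t\<in>carrier G. s \<noteq> t \<longrightarrow>
        (\<lambda>i. real (card {a \<in> {1..d i}. \<sigma> i s a \<noteq> \<sigma> i t a}) / real (d i)) \<longlonglongrightarrow> 1)"

text \<open>A \<open>G\<close>-space is given by \<open>act\<close> on the metric space \<open>X :: 'x metric\<close>.\<close>

definition expansive ::
    "('g, 'b) monoid_scheme \<Rightarrow> ('g \<Rightarrow> 'x \<Rightarrow> 'x) \<Rightarrow> 'x metric \<Rightarrow> bool" where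
  "expansive G act X \<longleftrightarrow>
     (\<exists>\<delta>>0. \<forall>x\<in>mspace X. \<forall>y\<in>mspace X. x \<noteq> y \<longrightarrow>
        (\<exists>g\<in>carrier G. mdist X (act g x) (act g y) > \<delta>))"

definition finite_open_covers :: "'x metric \<Rightarrow> 'x set set set" where
  "finite_open_covers X =
     {\<U>. finite \<U> \<and> (\<forall>U\<in>\<U>. openin (mtopology_of X) U) \<and> \<Union>\<U> = mspace X}"

definition covering_number :: "'x set set \<Rightarrow> 'x set \<Rightarrow> nat" where
  "covering_number \<V> K = (LEAST n. \<exists>\<W>\<subseteq>\<V>. finite \<W> \<and> K \<subseteq> \<Union>\<W> \<and> card \<W> = n)"

text \<open>Points of the power \<open>X\<^sup>n\<close> are extensional functions on \<open>{1..n}\<close>.\<close>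

definition cover_power :: "'x set set \<Rightarrow> nat \<Rightarrow> (nat \<Rightarrow> 'x) set set" where
  "cover_power \<U> n = {PiE {1..n} U |U. \<forall>j\<in>{1..n}. U j \<in> \<U>}"

definition approx_orbits ::
    "('g \<Rightarrow> 'x \<Rightarrow> 'x) \<Rightarrow> 'x metric \<Rightarrow> nat \<Rightarrow> 'g set \<Rightarrow> real \<Rightarrow> ('g \<Rightarrow> nat \<Rightarrow> nat) \<Rightarrow>
     (nat \<Rightarrow> 'x) set" where
  "approx_orbits act X n F \<delta> \<tau> =
     {x \<in> {1..n} \<rightarrow>\<^sub>E mspace X.
        Max ((\<lambda>s. sqrt (\<Sum>j=1..n. 1 / real n * (mdist X (act s (x j)) (x (\<tau> s j)))\<^sup>2)) ` F) < \<delta>}"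

text \<open>Logarithm of a natural number with the convention \<open>log 0 = -\<infinity>\<close>.\<close>

definition elog :: "nat \<Rightarrow> ereal" where
  "elog n = (if n = 0 then -\<infinity> else ereal (ln (real n)))"

definition cond_cover_entropy ::
    "('g, 'b) monoid_scheme \<Rightarrow> (nat \<Rightarrow> nat) \<Rightarrow> (nat \<Rightarrow> 'g \<Rightarrow> nat \<Rightarrow> nat) \<Rightarrow>
     ('g \<Rightarrow> 'x \<Rightarrow> 'x) \<Rightarrow> 'x metric \<Rightarrow> 'x set set \<Rightarrow> 'x set set \<Rightarrow> ereal" where
  "cond_cover_entropy G d \<sigma> act X \<U>1 \<U>2 =
     (INF F \<in> {F. finite F \<and> F \<noteq> {} \<and> F \<subseteq> carrier G}. INF \<delta> \<in> {0<..}.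
        limsup (\<lambda>i. ereal (1 / real (d i)) *
          elog (Max ((\<lambda>V. covering_number (cover_power \<U>1 (d i))
                            (approx_orbits act X (d i) F \<delta> (\<sigma> i) \<inter> V)) `
                     cover_power \<U>2 (d i)))))"

definition cond_entropy ::
    "('g, 'b) monoid_scheme \<Rightarrow> (nat \<Rightarrow> nat) \<Rightarrow> (nat \<Rightarrow> 'g \<Rightarrow> nat \<Rightarrow> nat) \<Rightarrow>
     ('g \<Rightarrow> 'x \<Rightarrow> 'x) \<Rightarrow> 'x metric \<Rightarrow> 'x set set \<Rightarrow> ereal" where
  "cond_entropy G d \<sigma> act X \<U>2 =
     (SUP \<U>1 \<in> finite_open_covers X. cond_cover_entropy G d \<sigma> act X \<U>1 \<U>2)"

definition h_expansive ::
    "('g, 'b) monoid_scheme \<Rightarrow> (nat \<Rightarrow> nat) \<Rightarrow> (nat \<Rightarrow> 'g \<Rightarrow> nat \<Rightarrow> nat) \<Rightarrow>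
     ('g \<Rightarrow> 'x \<Rightarrow> 'x) \<Rightarrow> 'x metric \<Rightarrow> bool" where
  "h_expansive G d \<sigma> act X \<longleftrightarrow>
     (\<exists>\<U>\<in>finite_open_covers X. cond_entropy G d \<sigma> act X \<U> \<le> 0)"

end

theory Submission
  imports Defs
begin

text \<open>
  By compactness every finite open cover of the boundary is refined by the cylinders of some level
  \<open>N\<close>, so the relevant covering numbers are bounded by the number of level-\<open>N\<close> itineraries
  \<open>{1..d} \<rightarrow> G/G\<^sub>N\<close> of approximate orbits. Let \<open>G\<close> be infinite and \<open>F\<close> a large finite subset. Up to
  a small proportion of bad places \<open>j\<close> an itinerary \<open>\<phi>\<close> satisfies \<open>\<phi> (\<sigma>\<^sub>s j) = s \<phi> j\<close> for \<open>s \<in> F\<close>, and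
  the points \<open>\<sigma>\<^sub>s j\<close> are distinct. Choose a maximal set \<open>J\<close> of good places with pairwise disjoint
  partial orbits \<open>{\<sigma>\<^sub>s j | s \<in> F}\<close>; then \<open>J\<close> has at most \<open>d / |F|\<close> elements, and by maximality \<open>\<phi>\<close>
  is determined by its values on \<open>J\<close> and on the bad places. Hence the number of itineraries
  grows subexponentially and already the trivial cover witnesses h-expansiveness. If \<open>G\<close> is finite,
  the boundary is finite and the cover by singletons works.

  The action permutes the cylinders of each level, so two points in a common small cylinder stay
  close forever; an infinite boundary has such pairs at every level.
\<close>

section \<open>Counting approximately equivariant maps\<close>

text \<open>The exponent \<open>m\<close> is the size of a set that determines every such map: a
  maximal packing \<open>J\<close> of good places with disjoint partial orbits, together with the
  places outside \<open>A\<close>. Freeness makes each partial orbit as large as \<open>F\<close>,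
  so disjointness bounds the size of \<open>J\<close>.\<close>

lemma card_equivariant_maps_le:
  fixes D :: "'a set" and F :: "'s set" and Q :: "'q set"
    and \<tau> :: "'s \<Rightarrow> 'a \<Rightarrow> 'a" and act :: "'s \<Rightarrow> 'q \<Rightarrow> 'q"
  assumes D: "finite D" and A: "A \<subseteq> D" and Q: "finite Q"
    and F: "finite F" "F \<noteq> {}"
    and \<tau>: "\<And>s a. s \<in> F \<Longrightarrow> a \<in> A \<Longrightarrow> \<tau> s a \<in> D"
    and free: "\<And>a. a \<in> A \<Longrightarrow> inj_on (\<lambda>s. \<tau> s a) F"
    and act: "\<And>s. s \<in> F \<Longrightarrow> inj_on (act s) Q"
  obtains m where
    "card {\<phi> \<in> D \<rightarrow>\<^sub>E Q. \<forall>a\<in>A. \<forall>s\<in>F. \<phi> (\<tau> s a) = act s (\<phi> a)} \<le> card Q ^ m"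
    "real m \<le> real (card D) / real (card F) + real (card (D - A))"
proof -
  define \<Phi> where "\<Phi> = {\<phi> \<in> D \<rightarrow>\<^sub>E Q. \<forall>a\<in>A. \<forall>s\<in>F. \<phi> (\<tau> s a) = act s (\<phi> a)}"
  define orb where "orb a = (\<lambda>s. \<tau> s a) ` F" for a
  have finA: "finite A" using D A finite_subset by blast
  obtain J where J: "J \<subseteq> A" "disjoint_family_on orb J"
    and max: "\<And>J'. J' \<subseteq> A \<Longrightarrow> disjoint_family_on orb J' \<Longrightarrow> J \<subseteq> J' \<Longrightarrow> J = J'"
  proof -
    have "{} \<in> {J \<in> Pow A. disjoint_family_on orb J}" by (simp add: disjoint_family_on_def)
    moreover have "finite {J \<in> Pow A. disjoint_family_on orb J}" using finA by simp
    ultimately obtain J where "J \<in> {J \<in> Pow A. disjoint_family_on orb J}"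
      "\<forall>J'\<in>{J \<in> Pow A. disjoint_family_on orb J}. J \<subseteq> J' \<longrightarrow> J = J'"
      using finite_has_maximal2[of "{J \<in> Pow A. disjoint_family_on orb J}" "{}"] by blast
    then show ?thesis using that[of J] by simp
  qed
  have finJ: "finite J" using J(1) finA finite_subset by blast
  have "card J * card F = (\<Sum>a\<in>J. card (orb a))"
    using free J(1) by (simp add: orb_def card_image subset_iff)
  also have "\<dots> = card (\<Union>a\<in>J. orb a)"
    using J(2) finJ F(1) by (intro card_UN_disjoint[symmetric]) (auto simp: orb_def disjoint_family_on_def)
  also have "\<dots> \<le> card D"
    using \<tau> J(1) by (intro card_mono D) (auto simp: orb_def)
  finally have "real (card J) * real (card F) \<le> real (card D)"
    by (metis of_nat_le_iff of_nat_mult)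
  then have cardJ: "real (card J) \<le> real (card D) / real (card F)"
    using F by (simp add: field_simps card_gt_0_iff)
  \<comment> \<open>The determining set: the packing carries the equivariant part of a map, while
    nothing is known on \<open>D - A\<close>.\<close>
  define S where "S = J \<union> (D - A)"
  have finS: "finite S" using finJ D by (auto simp: S_def)
  have "inj_on (\<lambda>\<phi>. restrict \<phi> S) \<Phi>"
  proof (rule inj_onI)
    fix \<phi> \<psi> assume \<phi>: "\<phi> \<in> \<Phi>" and \<psi>: "\<psi> \<in> \<Phi>" and eq: "restrict \<phi> S = restrict \<psi> S"
    have eqS: "\<phi> a = \<psi> a" if "a \<in> S" for a
      using fun_cong[OF eq, of a] that by simp
    have "\<phi> a = \<psi> a" if "a \<in> D" for a
    proof (cases "a \<in> S")
      case False
      then have a: "a \<in> A" "a \<notin> J" using that by (auto simp: S_def)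
      \<comment> \<open>By maximality the partial orbit of \<open>a\<close> meets that of some
        \<open>b\<close> in \<open>J\<close>, so \<open>act s (\<phi> a) = act t (\<phi> b)\<close>.
        Cancelling the injective \<open>act s\<close> recovers \<open>\<phi> a\<close> from
        \<open>\<phi> b\<close>.\<close>
      have "\<not> disjoint_family_on orb (insert a J)"
        using max[of "insert a J"] a J(1) by blast
      then obtain b where b: "b \<in> J" "orb a \<inter> orb b \<noteq> {}"
        using J(2) unfolding disjoint_family_on_def by blast
      then obtain s t where st: "s \<in> F" "t \<in> F" "\<tau> s a = \<tau> t b"
        by (auto simp: orb_def)
      have "b \<in> S" "b \<in> A" using b(1) J(1) by (auto simp: S_def)
      then have "act s (\<phi> a) = act s (\<psi> a)"
      proof -
        have "act s (\<phi> a) = \<phi> (\<tau> s a)" "\<phi> (\<tau> t b) = act t (\<phi> b)"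
          "act s (\<psi> a) = \<psi> (\<tau> s a)" "\<psi> (\<tau> t b) = act t (\<psi> b)"
          using \<phi> \<psi> a(1) st(1,2) \<open>b \<in> A\<close> by (simp_all add: \<Phi>_def)
        then show ?thesis using eqS[OF \<open>b \<in> S\<close>] st(3) by simp
      qed
      moreover have "\<phi> a \<in> Q" "\<psi> a \<in> Q" using \<phi> \<psi> that by (auto simp: \<Phi>_def)
      ultimately show ?thesis using act[OF st(1)] by (auto dest: inj_onD)
    qed (rule eqS)
    then show "\<phi> = \<psi>" using \<phi> \<psi> by (auto simp: \<Phi>_def intro: PiE_ext)
  qed
  moreover have "(\<lambda>\<phi>. restrict \<phi> S) ` \<Phi> \<subseteq> S \<rightarrow>\<^sub>E Q"
  proof (rule image_subsetI)
    fix \<phi> assume "\<phi> \<in> \<Phi>"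
    moreover have "S \<subseteq> D" using J(1) A by (auto simp: S_def)
    ultimately have "\<forall>a\<in>S. \<phi> a \<in> Q" by (auto simp: \<Phi>_def)
    then show "restrict \<phi> S \<in> S \<rightarrow>\<^sub>E Q" by (simp add: restrict_PiE_iff)
  qed
  ultimately have "card \<Phi> \<le> card (S \<rightarrow>\<^sub>E Q)"
    using finS Q by (intro card_inj_on_le finite_PiE) auto
  then have "card \<Phi> \<le> card Q ^ card S" using finS by (simp add: card_funcsetE)
  moreover have "real (card S) \<le> real (card D) / real (card F) + real (card (D - A))"
    using cardJ card_Un_le[of J "D - A"] by (simp add: S_def)
  ultimately show ?thesis using that unfolding \<Phi>_def by blast
qed

text \<open>The Chernoff trick: each small set has weight \<open>t ^ card B\<close> at least \<open>t powr c\<close> in the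
  binomial expansion of \<open>(1 + t) ^ card D\<close>.\<close>

lemma card_small_subsets_le:
  fixes t c :: real
  assumes D: "finite D" and t: "0 < t" "t \<le> 1"
  shows "real (card {B \<in> Pow D. real (card B) \<le> c}) \<le> exp (real (card D) * t - c * ln t)"
proof -
  define \<B> where "\<B> = {B \<in> Pow D. real (card B) \<le> c}"
  have "real (card \<B>) * t powr c = (\<Sum>B\<in>\<B>. t powr c)" by simp
  also have "\<dots> \<le> (\<Sum>B\<in>\<B>. t ^ card B)"
    using t by (intro sum_mono) (simp add: \<B>_def powr_mono' flip: powr_realpow)
  also have "\<dots> \<le> (\<Sum>B\<in>Pow D. t ^ card B)"
    using t D by (intro sum_mono2) (auto simp: \<B>_def)
  also have "\<dots> = (1 + t) ^ card D"
    using prod_add[OF D, of "\<lambda>_. t" "\<lambda>_. 1"] by (simp add: add.commute)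
  also have "\<dots> \<le> exp t ^ card D"
    using t by (intro power_mono) auto
  finally have "real (card \<B>) * exp (c * ln t) \<le> exp (real (card D) * t)"
    using t by (simp add: powr_def exp_of_nat_mult)
  then show ?thesis
    unfolding \<B>_def exp_diff by (simp add: pos_le_divide_eq)
qed

text \<open>Sort the maps by their sets \<open>B\<close> of bad places. The terms
  \<open>t - \<eta> * ln t\<close> of the exponent count the possible \<open>B\<close>; the
  remaining terms count the maps for one \<open>B\<close>, which are equivariant on
  \<open>D - B\<close>. The parameter \<open>t\<close> stays free so that it can be tuned
  later.\<close>

lemma card_almost_equivariant_maps_le:
  fixes D :: "'a set" and F :: "'s set" and Q :: "'q set" and \<eta> t :: real
    and \<tau> :: "'s \<Rightarrow> 'a \<Rightarrow> 'a" and act :: "'s \<Rightarrow> 'q \<Rightarrow> 'q"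
  assumes D: "finite D" and Q: "finite Q" "Q \<noteq> {}"
    and F: "finite F" "F \<noteq> {}"
    and \<tau>: "\<And>s a. s \<in> F \<Longrightarrow> a \<in> D \<Longrightarrow> \<tau> s a \<in> D"
    and act: "\<And>s. s \<in> F \<Longrightarrow> inj_on (act s) Q"
    and t: "0 < t" "t \<le> 1"
    and P: "P \<subseteq> D \<rightarrow>\<^sub>E Q"
    and bad: "\<And>\<phi>. \<phi> \<in> P \<Longrightarrow>
      real (card {a \<in> D. \<not> (inj_on (\<lambda>s. \<tau> s a) F \<and> (\<forall>s\<in>F. \<phi> (\<tau> s a) = act s (\<phi> a)))})
        \<le> \<eta> * real (card D)"
  shows "real (card P) \<le>
    exp (real (card D) * (t - \<eta> * ln t + (1 / real (card F) + \<eta>) * ln (real (card Q))))"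
proof -
  define L where "L = ln (real (card Q))"
  have Q1: "real (card Q) \<ge> 1" using Q by (simp add: Suc_le_eq card_gt_0_iff)
  then have L: "L \<ge> 0" by (simp add: L_def)
  define \<B> where "\<B> = {B \<in> Pow D. real (card B) \<le> \<eta> * real (card D)}"
  \<comment> \<open>Injectivity of \<open>\<lambda>s. \<tau> s a\<close> does not involve \<phi>, so
    it can be imposed on \<open>B\<close> itself; it is the freeness required for counting with
    \<open>A = D - B\<close>.\<close>
  define \<B>' where "\<B>' = {B \<in> \<B>. \<forall>a\<in>D - B. inj_on (\<lambda>s. \<tau> s a) F}"
  define \<Phi> where "\<Phi> B = {\<phi> \<in> D \<rightarrow>\<^sub>E Q. \<forall>a\<in>D - B. \<forall>s\<in>F. \<phi> (\<tau> s a) = act s (\<phi> a)}" for B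
  define c where "c = real (card D) * ((1 / real (card F) + \<eta>) * L)"
  have fin\<B>: "finite \<B>" using D by (simp add: \<B>_def)
  then have fin\<B>': "finite \<B>'" by (simp add: \<B>'_def)
  have fin\<Phi>: "finite (\<Phi> B)" for B
    using finite_PiE[OF D, of "\<lambda>_. Q"] Q(1) by (simp add: \<Phi>_def)
  have "P \<subseteq> (\<Union>B\<in>\<B>'. \<Phi> B)"
  proof
    fix \<phi> assume \<phi>: "\<phi> \<in> P"
    define B where "B = {a \<in> D. \<not> (inj_on (\<lambda>s. \<tau> s a) F \<and> (\<forall>s\<in>F. \<phi> (\<tau> s a) = act s (\<phi> a)))}"
    have "B \<in> \<B>'" "\<phi> \<in> \<Phi> B"
      using bad[OF \<phi>] P \<phi> by (auto simp: B_def \<B>'_def \<B>_def \<Phi>_def)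
    then show "\<phi> \<in> (\<Union>B\<in>\<B>'. \<Phi> B)" by blast
  qed
  then have "card P \<le> card (\<Union>B\<in>\<B>'. \<Phi> B)"
    using fin\<B>' fin\<Phi> by (intro card_mono) auto
  also have "\<dots> \<le> (\<Sum>B\<in>\<B>'. card (\<Phi> B))" by (rule card_UN_le[OF fin\<B>'])
  finally have "real (card P) \<le> (\<Sum>B\<in>\<B>'. real (card (\<Phi> B)))"
    by (metis of_nat_le_iff of_nat_sum)
  also have "\<dots> \<le> (\<Sum>B\<in>\<B>'. exp c)"
  proof (rule sum_mono)
    fix B assume B: "B \<in> \<B>'"
    then have DB: "D - (D - B) = B" by (auto simp: \<B>'_def \<B>_def)
    obtain m where m: "card (\<Phi> B) \<le> card Q ^ m"
      "real m \<le> real (card D) / real (card F) + real (card B)"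
    proof (rule card_equivariant_maps_le[of D "D - B" Q F \<tau> act])
      show "inj_on (\<lambda>s. \<tau> s a) F" if "a \<in> D - B" for a
        using B that by (auto simp: \<B>'_def)
    qed (use D Q(1) F \<tau> act that DB in \<open>auto simp: \<Phi>_def\<close>)
    have "real m \<le> real (card D) / real (card F) + \<eta> * real (card D)"
      using m(2) B by (auto simp: \<B>'_def \<B>_def)
    then have mL: "real m * L \<le> c"
      using mult_right_mono[OF _ L, of "real m" "real (card D) / real (card F) + \<eta> * real (card D)"]
      by (simp add: c_def algebra_simps)
    have "real (card (\<Phi> B)) \<le> real (card Q) ^ m"
      using m(1) by (metis of_nat_le_iff of_nat_power)
    also have "\<dots> = exp (real m * L)"
      using Q1 by (simp add: L_def exp_of_nat_mult)
    also have "\<dots> \<le> exp c" using mL by simp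
    finally show "real (card (\<Phi> B)) \<le> exp c" .
  qed
  also have "\<dots> \<le> real (card \<B>) * exp c"
    using fin\<B> by (simp add: \<B>'_def card_mono)
  also have "\<dots> \<le> exp (real (card D) * t - \<eta> * real (card D) * ln t) * exp c"
    using card_small_subsets_le[OF D t, of "\<eta> * real (card D)"]
    by (intro mult_right_mono) (simp_all add: \<B>_def)
  also have "\<dots> = exp (real (card D) * (t - \<eta> * ln t + (1 / real (card F) + \<eta>) * L))"
    by (simp add: c_def algebra_simps flip: exp_add)
  finally show ?thesis by (simp add: L_def)
qed

section \<open>The boundary of the coset tree\<close>

locale coset_tree = group G for G (structure) +
  fixes H :: "nat \<Rightarrow> 'a set"
  assumes chain: "group_chain G H"
begin

lemma subgroup_H: "subgroup (H n) G"
  and finite_lcosets_H: "finite (lcosets (H n))"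
  and H_Suc_subset: "H (Suc n) \<subseteq> H n"
  and H_0: "H 0 = carrier G"
  using chain by (auto simp: group_chain_def)

lemma boundary_iff:
  "x \<in> tree_boundary G H \<longleftrightarrow> (\<forall>n. x n \<in> lcosets (H n)) \<and> (\<forall>n. x (Suc n) \<subseteq> x n)"
  by (auto simp: tree_boundary_def tree_vertices_def tree_edges_def)

lemma boundary_lcosets: "x \<in> tree_boundary G H \<Longrightarrow> x n \<in> lcosets (H n)"
  by (simp add: boundary_iff)

lemma boundary_antimono: "x \<in> tree_boundary G H \<Longrightarrow> m \<le> n \<Longrightarrow> x n \<subseteq> x m"
  by (rule lift_Suc_antimono_le) (auto simp: boundary_iff)

lemma lcosets_nonempty: "C \<in> lcosets (H n) \<Longrightarrow> C \<noteq> {}"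
  using lcos_self[OF _ subgroup_H] by (auto simp: LCOSETS_def)

lemma lcosets_eqI:
  "C \<in> lcosets (H n) \<Longrightarrow> D \<in> lcosets (H n) \<Longrightarrow> C \<inter> D \<noteq> {} \<Longrightarrow> C = D"
  using lcos_disjoint[OF subgroup_H] by blast

text \<open>Ancestors in a tree are unique: the nonempty coset \<open>x n\<close> lies in both
  \<open>x m\<close> and \<open>y m\<close>, and distinct cosets of \<open>H m\<close> are
  disjoint.\<close>

lemma boundary_eq_below:
  assumes "x \<in> tree_boundary G H" "y \<in> tree_boundary G H" "x n = y n" "m \<le> n"
  shows "x m = y m"
proof (rule lcosets_eqI[of _ m])
  have "x n \<subseteq> x m" "x n \<subseteq> y m" using assms boundary_antimono by metis+
  then show "x m \<inter> y m \<noteq> {}" using lcosets_nonempty boundary_lcosets assms(1) by blast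
qed (use assms boundary_lcosets in auto)

lemma boundary_cylinder_antimono:
  assumes "z \<in> tree_boundary G H" "m \<le> n"
  shows "boundary_cylinder G H n (z n) \<subseteq> boundary_cylinder G H m (z m)"
  using boundary_eq_below[OF _ assms(1) _ assms(2)] by (auto simp: boundary_cylinder_def)

lemma boundary_nonempty: "tree_boundary G H \<noteq> {}"
proof -
  have "H n \<in> lcosets (H n)" for n
    using lcos_mult_one[OF subgroup.subset[OF subgroup_H]] by (force simp: LCOSETS_def)
  \<comment> \<open>The chain itself is the ray of cosets of the identity.\<close>
  then have "H \<in> tree_boundary G H" by (simp add: boundary_iff H_Suc_subset)
  then show ?thesis by blast
qed

lemma lcosets_act:
  assumes "g \<in> carrier G" "C \<in> lcosets (H n)"
  shows "g <# C \<in> lcosets (H n)"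
  using assms lcos_m_assoc[OF subgroup.subset[OF subgroup_H]]
  by (auto simp: LCOSETS_def)

text \<open>Translation by \<open>inv g\<close> undoes translation by \<open>g\<close>. This is the
  cancellation needed to count itineraries.\<close>

lemma inj_on_l_coset:
  assumes "g \<in> carrier G" shows "inj_on (\<lambda>C. g <# C) (lcosets (H n))"
proof (rule inj_on_inverseI[where g = "\<lambda>C. inv g <# C"])
  fix C assume "C \<in> lcosets (H n)"
  then have "C \<subseteq> carrier G" using lcosets_subset_PowG[OF subgroup_H] by blast
  then show "inv g <# (g <# C) = C" using assms by (simp add: lcos_m_assoc lcos_mult_one)
qed

lemma profinite_action_boundary:
  assumes "g \<in> carrier G" "x \<in> tree_boundary G H"
  shows "profinite_action G g x \<in> tree_boundary G H"
proof -
  have "g <# x (Suc n) \<subseteq> g <# x n" for n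
    using assms(2) unfolding boundary_iff l_coset_def by blast
  then show ?thesis using assms by (simp add: boundary_iff profinite_action_def lcosets_act)
qed

text \<open>Compactness of the boundary, in the form of a Lebesgue number lemma for cylinders; the
  proof is Koenig's lemma for the infinitely often bad vertices.\<close>

lemma boundary_uniform_level:
  assumes mono: "\<And>S T. P T \<Longrightarrow> S \<subseteq> T \<Longrightarrow> P S"
    and loc: "\<And>z. z \<in> tree_boundary G H \<Longrightarrow> \<exists>n. P (boundary_cylinder G H n (z n))"
  shows "\<exists>N. \<forall>z\<in>tree_boundary G H. P (boundary_cylinder G H N (z N))"
proof (rule ccontr)
  assume nt: "\<not> ?thesis"
  \<comment> \<open>Bad vertices: \<open>bad n C N\<close> holds if some ray through
    \<open>C\<close> at level \<open>n\<close> has a level-\<open>N\<close> cylinder violating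
    \<open>P\<close>.\<close>
  define bad where
    "bad n C N \<longleftrightarrow> (\<exists>z\<in>tree_boundary G H. z n = C \<and> \<not> P (boundary_cylinder G H N (z N)))" for n C N
  \<comment> \<open>Pigeonhole: infinitely many \<open>N\<close> are distributed over the finitely
    many cosets of level \<open>n\<close>. The predicate \<open>R\<close> carries the adjacency to
    the parent vertex.\<close>
  have split: "\<exists>D\<in>lcosets (H n). infinite {N. Q N \<and> bad n D N \<and> R D N}"
    if "infinite {N. Q N}" "\<And>N. Q N \<Longrightarrow> \<exists>D\<in>lcosets (H n). bad n D N \<and> R D N" for n Q R
  proof (rule ccontr)
    assume "\<not> ?thesis"
    then have "finite (\<Union>D\<in>lcosets (H n). {N. Q N \<and> bad n D N \<and> R D N})"
      using finite_lcosets_H by auto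
    moreover have "{N. Q N} \<subseteq> (\<Union>D\<in>lcosets (H n). {N. Q N \<and> bad n D N \<and> R D N})"
      using that(2) by auto
    ultimately show False using that(1) finite_subset by blast
  qed
  have "\<exists>f. \<forall>n. (f n \<in> lcosets (H n) \<and> infinite {N. bad n (f n) N}) \<and> f (Suc n) \<subseteq> f n"
  proof (rule dependent_nat_choice)
    have "\<exists>D\<in>lcosets (H 0). bad 0 D N \<and> True" for N
      using nt boundary_lcosets unfolding bad_def by blast
    then have "\<exists>D\<in>lcosets (H 0). infinite {N. True \<and> bad 0 D N \<and> True}"
      by (intro split) auto
    then show "\<exists>C. C \<in> lcosets (H 0) \<and> infinite {N. bad 0 C N}" by auto
  next
    fix C n assume C: "C \<in> lcosets (H n) \<and> infinite {N. bad n C N}"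
    have "\<exists>D\<in>lcosets (H (Suc n)). infinite {N. bad n C N \<and> bad (Suc n) D N \<and> D \<subseteq> C}"
    proof (rule split)
      fix N assume "bad n C N"
      then obtain z where z: "z \<in> tree_boundary G H" "z n = C" "\<not> P (boundary_cylinder G H N (z N))"
        by (auto simp: bad_def)
      then have "z (Suc n) \<in> lcosets (H (Suc n))" "z (Suc n) \<subseteq> C" by (auto simp: boundary_iff)
      then show "\<exists>D\<in>lcosets (H (Suc n)). bad (Suc n) D N \<and> D \<subseteq> C"
        using z by (auto simp: bad_def)
    qed (use C in simp)
    then obtain D where D: "D \<in> lcosets (H (Suc n))"
      "infinite {N. bad n C N \<and> bad (Suc n) D N \<and> D \<subseteq> C}" by blast
    then have "infinite {N. bad (Suc n) D N}" by (rule_tac infinite_super[rotated]) auto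
    \<comment> \<open>The inclusion does not depend on \<open>N\<close>, so a single member of the
      infinite set provides it.\<close>
    moreover have "D \<subseteq> C" using D(2) not_finite_existsD by blast
    ultimately show "\<exists>D. (D \<in> lcosets (H (Suc n)) \<and> infinite {N. bad (Suc n) D N}) \<and> D \<subseteq> C"
      using D(1) by blast
  qed
  then obtain f where f: "\<And>n. f n \<in> lcosets (H n)" "\<And>n. infinite {N. bad n (f n) N}"
    "\<And>n. f (Suc n) \<subseteq> f n" by blast
  then have "f \<in> tree_boundary G H" by (simp add: boundary_iff)
  \<comment> \<open>The branch \<open>f\<close> has a cylinder of some level \<open>n\<close>
    satisfying \<open>P\<close>, but \<open>f n\<close> is bad for some \<open>N \<ge> n\<close>;
    the violating cylinder lies inside the good one, against monotonicity.\<close>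
  then obtain n where n: "P (boundary_cylinder G H n (f n))" using loc by blast
  obtain N where "N \<ge> n" "bad n (f n) N"
    using f(2)[of n] unfolding infinite_nat_iff_unbounded_le by blast
  then obtain z where z: "z \<in> tree_boundary G H" "z n = f n" "\<not> P (boundary_cylinder G H N (z N))"
    by (auto simp: bad_def)
  show False using mono[OF n] boundary_cylinder_antimono[OF z(1) \<open>N \<ge> n\<close>] z by simp
qed

text \<open>The cylinders through \<open>z\<close> are nested, so an intersection is handled at the
  larger of two levels. A generating cylinder that contains \<open>z\<close> is already a cylinder
  of the form \<open>boundary_cylinder G H n (z n)\<close>.\<close>

lemma boundary_open_cylinder:
  assumes "openin (boundary_topology G H) U" "z \<in> U" "z \<in> tree_boundary G H"
  shows "\<exists>n. boundary_cylinder G H n (z n) \<subseteq> U"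
proof -
  have "generate_topology_on {boundary_cylinder G H N C |N C. C \<in> lcosets (H N)} U"
    using assms(1) by (simp add: boundary_topology_def openin_topology_generated_by)
  then show ?thesis using assms(2)
  proof induction
    case (Int a b)
    then obtain m n where "boundary_cylinder G H m (z m) \<subseteq> a" "boundary_cylinder G H n (z n) \<subseteq> b"
      by auto
    then have "boundary_cylinder G H (max m n) (z (max m n)) \<subseteq> a \<inter> b"
      using boundary_cylinder_antimono[OF assms(3), of m "max m n"]
        boundary_cylinder_antimono[OF assms(3), of n "max m n"] by auto
    then show ?case by blast
  next
    case (UN K) then show ?case by blast
  next
    case (Basis s) then show ?case by (auto simp: boundary_cylinder_def)
  qed simp
qed

lemma openin_boundary_cylinder:
  "C \<in> lcosets (H n) \<Longrightarrow> openin (boundary_topology G H) (boundary_cylinder G H n C)"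
  unfolding boundary_topology_def by (rule topology_generated_by_Basis) blast

text \<open>In a finite group the chain stabilizes where \<open>card (H n)\<close> is minimal. From
  that level on a ray is a nested sequence of cosets of one subgroup, hence constant, so it is
  determined by its entry at level \<open>n\<close>.\<close>

lemma finite_boundary:
  assumes "finite (carrier G)"
  shows "finite (tree_boundary G H)"
proof -
  obtain n where n: "\<And>m. card (H n) \<le> card (H m)"
    using ex_has_least_nat[of "\<lambda>_. True" 0 "\<lambda>m. card (H m)"] by auto
  have stable: "H m = H n" if "n \<le> m" for m
  proof (rule card_seteq)
    show "finite (H n)" using assms subgroup.subset[OF subgroup_H] finite_subset by blast
    show "H m \<subseteq> H n" using lift_Suc_antimono_le[of H, OF H_Suc_subset that] .
  qed (rule n)
  have "inj_on (\<lambda>x. x n) (tree_boundary G H)"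
  proof (rule inj_onI, rule ext)
    fix x y m assume xy: "x \<in> tree_boundary G H" "y \<in> tree_boundary G H" "x n = y n"
    have const: "z m = z n" if "z \<in> tree_boundary G H" "n \<le> m" for z
    proof (rule lcosets_eqI[of _ n])
      show "z m \<in> lcosets (H n)" using boundary_lcosets[OF that(1), of m] stable[OF that(2)] by simp
      show "z m \<inter> z n \<noteq> {}"
        using boundary_antimono[OF that] lcosets_nonempty[OF boundary_lcosets[OF that(1)]] by blast
    qed (rule boundary_lcosets[OF that(1)])
    show "x m = y m"
      using boundary_eq_below[OF xy] const xy by (metis nat_le_linear)
  qed
  moreover have "(\<lambda>x. x n) ` tree_boundary G H \<subseteq> lcosets (H n)" using boundary_lcosets by blast
  ultimately show ?thesis using finite_lcosets_H inj_on_finite by blast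
qed

end

section \<open>Cylinders and balls of a compatible metric\<close>

locale metric_coset_tree = coset_tree +
  fixes X :: "(nat \<Rightarrow> 'a set) metric"
  assumes mspace_X: "mspace X = tree_boundary G H"
    and mtopology_X: "mtopology_of X = boundary_topology G H"
begin

lemma openin_X_iff:
  "openin (boundary_topology G H) U \<longleftrightarrow>
     U \<subseteq> tree_boundary G H \<and> (\<forall>x\<in>U. \<exists>r>0. \<forall>y\<in>tree_boundary G H. mdist X x y < r \<longrightarrow> y \<in> U)"
proof -
  have ball: "mball_of X x r \<subseteq> U \<longleftrightarrow> (\<forall>y\<in>tree_boundary G H. mdist X x y < r \<longrightarrow> y \<in> U)"
    if "x \<in> tree_boundary G H" for x r
    using that mspace_X by auto
  have "openin (mtopology_of X) U \<longleftrightarrow> U \<subseteq> mspace X \<and> (\<forall>x. x \<in> U \<longrightarrow> (\<exists>r>0. mball_of X x r \<subseteq> U))"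
    unfolding mtopology_of_def mball_of_def
    by (rule Metric_space.openin_mtopology[OF Metric_space_mspace_mdist])
  also have "\<dots> \<longleftrightarrow> U \<subseteq> tree_boundary G H \<and>
      (\<forall>x\<in>U. \<exists>r>0. \<forall>y\<in>tree_boundary G H. mdist X x y < r \<longrightarrow> y \<in> U)"
    unfolding Ball_def[of U] mspace_X
    by (intro all_cong1 imp_cong ex_cong1 conj_cong refl ball) blast
  finally show ?thesis unfolding mtopology_X .
qed

lemma openin_ball:
  assumes "z \<in> tree_boundary G H"
  shows "openin (boundary_topology G H) {y \<in> tree_boundary G H. mdist X z y < r}"
proof -
  have "{y \<in> tree_boundary G H. mdist X z y < r} = mball_of X z r"
    by (rule Set.set_eqI) (simp add: assms mspace_X)
  moreover have "openin (mtopology_of X) (mball_of X z r)"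
    unfolding mtopology_of_def mball_of_def
    by (rule Metric_space.openin_mball[OF Metric_space_mspace_mdist])
  ultimately show ?thesis by (simp only: mtopology_X)
qed

lemma cylinder_in_ball:
  assumes "z \<in> tree_boundary G H" "r > 0"
  shows "\<exists>n. \<forall>y\<in>boundary_cylinder G H n (z n). mdist X z y < r"
proof -
  have "mdist X z z = 0" using assms(1) mspace_X by simp
  then have "z \<in> {y \<in> tree_boundary G H. mdist X z y < r}" using assms by simp
  then obtain n where "boundary_cylinder G H n (z n) \<subseteq> {y \<in> tree_boundary G H. mdist X z y < r}"
    using boundary_open_cylinder[OF openin_ball[OF assms(1)] _ assms(1)] by meson
  then show ?thesis by blast
qed

text \<open>Around each point some cylinder lies in a ball of radius \<open>\<delta> / 2\<close>,
  hence all distances within it are below \<delta>; compactness makes the level uniform.\<close>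

lemma small_cylinders:
  assumes "\<delta> > 0"
  shows "\<exists>N. \<forall>x\<in>tree_boundary G H. \<forall>y\<in>tree_boundary G H. x N = y N \<longrightarrow> mdist X x y < \<delta>"
proof -
  define P where "P S \<longleftrightarrow> (\<forall>x\<in>S. \<forall>y\<in>S. mdist X x y < \<delta>)" for S
  have "\<exists>N. \<forall>z\<in>tree_boundary G H. P (boundary_cylinder G H N (z N))"
  proof (rule boundary_uniform_level[of P])
    fix z assume z: "z \<in> tree_boundary G H"
    then obtain n where n: "\<And>y. y \<in> boundary_cylinder G H n (z n) \<Longrightarrow> mdist X z y < \<delta> / 2"
      using cylinder_in_ball[OF z half_gt_zero[OF assms]] by blast
    have "mdist X x y < \<delta>"
      if "x \<in> boundary_cylinder G H n (z n)" "y \<in> boundary_cylinder G H n (z n)" for x y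
    proof -
      have "mdist X x y \<le> mdist X x z + mdist X z y"
        using that z by (intro mdist_triangle) (auto simp: mspace_X boundary_cylinder_def)
      then show ?thesis using n[OF that(1)] n[OF that(2)] mdist_commute[of X x z] by argo
    qed
    then show "\<exists>n. P (boundary_cylinder G H n (z n))"
      unfolding P_def by blast
  next
    show "P S" if "P T" "S \<subseteq> T" for S T using that unfolding P_def by blast
  qed
  then obtain N where N: "\<And>z. z \<in> tree_boundary G H \<Longrightarrow> P (boundary_cylinder G H N (z N))"
    by meson
  have "mdist X x y < \<delta>" if "x \<in> tree_boundary G H" "y \<in> tree_boundary G H" "x N = y N" for x y
    using N[OF that(1)] that by (simp add: P_def boundary_cylinder_def)
  then show ?thesis by blast
qed

text \<open>Level-\<open>N\<close> cylinders are open, which gives a separating radius near each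
  point; compactness makes it uniform. It turns metric closeness into equality of
  level-\<open>N\<close> cosets.\<close>

lemma cylinders_separated:
  "\<exists>r>0. \<forall>x\<in>tree_boundary G H. \<forall>y\<in>tree_boundary G H. mdist X x y < r \<longrightarrow> x N = y N"
proof -
  \<comment> \<open>Only \<open>x\<close> is confined to \<open>S\<close>; \<open>y\<close> ranges
    over the whole boundary. The radius may depend on \<open>S\<close>.\<close>
  define P where
    "P S \<longleftrightarrow> (\<exists>r>0. \<forall>x\<in>S. \<forall>y\<in>tree_boundary G H. mdist X x y < r \<longrightarrow> x N = y N)" for S
  have "\<exists>M. \<forall>z\<in>tree_boundary G H. P (boundary_cylinder G H M (z M))"
  proof (rule boundary_uniform_level[of P])
    fix z assume z: "z \<in> tree_boundary G H"
    have "z \<in> boundary_cylinder G H N (z N)" using z by (simp add: boundary_cylinder_def)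
    then have "\<exists>r>0. \<forall>y\<in>tree_boundary G H. mdist X z y < r \<longrightarrow> y \<in> boundary_cylinder G H N (z N)"
      using openin_boundary_cylinder[OF boundary_lcosets[OF z, of N]] unfolding openin_X_iff by blast
    then obtain r where r: "r > 0" "\<And>y. y \<in> tree_boundary G H \<Longrightarrow> mdist X z y < r \<Longrightarrow> y N = z N"
      unfolding boundary_cylinder_def by blast
    obtain n where n: "\<And>y. y \<in> boundary_cylinder G H n (z n) \<Longrightarrow> mdist X z y < r / 2"
      using cylinder_in_ball[OF z half_gt_zero[OF r(1)]] by blast
    \<comment> \<open>Both \<open>x\<close> and \<open>y\<close> lie within \<open>r\<close> of
      \<open>z\<close>, so both share its coset of level \<open>N\<close>.\<close>
    have "x N = y N" if "x \<in> boundary_cylinder G H n (z n)" "y \<in> tree_boundary G H" "mdist X x y < r / 2" for x y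
    proof -
      have x: "x \<in> tree_boundary G H" using that by (simp add: boundary_cylinder_def)
      have "mdist X z y \<le> mdist X z x + mdist X x y"
        using that z x by (intro mdist_triangle) (auto simp: mspace_X)
      then show ?thesis using n[OF that(1)] r(1) r(2)[OF that(2)] r(2)[OF x] that(3) by simp
    qed
    then have "P (boundary_cylinder G H n (z n))"
      unfolding P_def using half_gt_zero[OF r(1)] by blast
    then show "\<exists>n. P (boundary_cylinder G H n (z n))" ..
  next
    show "P S" if "P T" "S \<subseteq> T" for S T using that unfolding P_def by blast
  qed
  then obtain M where M: "\<And>z. z \<in> tree_boundary G H \<Longrightarrow> P (boundary_cylinder G H M (z M))" by meson
  \<comment> \<open>The radius still varies with the level-\<open>M\<close> cylinder. There are
    finitely many of these, and at least one, so \<open>Min\<close> yields a common positive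
    radius.\<close>
  define V where "V = (\<lambda>z. z M) ` tree_boundary G H"
  have V: "finite V" "V \<noteq> {}"
    using boundary_lcosets boundary_nonempty finite_subset[OF _ finite_lcosets_H[of M], of V]
    by (auto simp: V_def)
  have "\<forall>C\<in>V. \<exists>r>0. \<forall>x\<in>boundary_cylinder G H M C. \<forall>y\<in>tree_boundary G H. mdist X x y < r \<longrightarrow> x N = y N"
    using M unfolding V_def P_def by blast
  then obtain \<rho> where \<rho>: "\<And>C. C \<in> V \<Longrightarrow> \<rho> C > (0::real)"
    "\<And>C x y. C \<in> V \<Longrightarrow> x \<in> boundary_cylinder G H M C \<Longrightarrow> y \<in> tree_boundary G H \<Longrightarrow>
       mdist X x y < \<rho> C \<Longrightarrow> x N = y N" by metis
  have "Min (\<rho> ` V) > 0" using V \<rho>(1) by simp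
  moreover have "x N = y N"
    if "x \<in> tree_boundary G H" "y \<in> tree_boundary G H" "mdist X x y < Min (\<rho> ` V)" for x y
    using that V by (intro \<rho>(2)[of "x M"]) (auto simp: V_def boundary_cylinder_def)
  ultimately show ?thesis by blast
qed

text \<open>Only finitely many cosets exist at level \<open>N\<close>, so an infinite boundary has
  two points sharing one. Every translate of the pair shares a coset again and stays closer than
  \<delta>.\<close>

lemma not_expansive:
  assumes "infinite (tree_boundary G H)"
  shows "\<not> expansive G (profinite_action G) X"
proof
  assume "expansive G (profinite_action G) X"
  then obtain \<delta> where \<delta>: "\<delta> > 0" "\<forall>x\<in>tree_boundary G H. \<forall>y\<in>tree_boundary G H. x \<noteq> y \<longrightarrow>
      (\<exists>g\<in>carrier G. mdist X (profinite_action G g x) (profinite_action G g y) > \<delta>)"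
    unfolding expansive_def mspace_X by (elim exE conjE)
  obtain N where N: "\<forall>x\<in>tree_boundary G H. \<forall>y\<in>tree_boundary G H. x N = y N \<longrightarrow> mdist X x y < \<delta>"
    using small_cylinders[OF \<delta>(1)] by (elim exE)
  have "(\<lambda>x. x N) ` tree_boundary G H \<subseteq> lcosets (H N)" using boundary_lcosets by blast
  then have "\<not> inj_on (\<lambda>x. x N) (tree_boundary G H)"
    using assms finite_lcosets_H inj_on_finite by blast
  then obtain x y where xy: "x \<in> tree_boundary G H" "y \<in> tree_boundary G H" "x N = y N" "x \<noteq> y"
    by (auto simp: inj_on_def)
  then obtain g where g: "g \<in> carrier G"
    "mdist X (profinite_action G g x) (profinite_action G g y) > \<delta>"
    using \<delta>(2) by meson
  have "profinite_action G g x N = profinite_action G g y N"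
    using xy(3) by (simp add: profinite_action_def)
  then have "mdist X (profinite_action G g x) (profinite_action G g y) < \<delta>"
    using N profinite_action_boundary[OF g(1)] xy by simp
  with g(2) show False by simp
qed

end

section \<open>Estimates for the entropy\<close>

lemma elog_le:
  assumes "real n \<le> exp c" shows "elog n \<le> ereal c"
proof (cases "n = 0")
  case False
  then have "ln (real n) \<le> ln (exp c)" using assms by (intro ln_mono) auto
  then show ?thesis using False by (simp add: elog_def)
qed (simp add: elog_def)

text \<open>Ensures that \<open>Max\<close> over the power cover is a genuine maximum. The families
  in \<open>cover_power\<close> are arbitrary outside \<open>{1..n}\<close>, so they are first
  restricted, which leaves finitely many.\<close>

lemma finite_cover_power:
  assumes "finite \<U>" shows "finite (cover_power \<U> n)"
proof (rule finite_subset)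
  show "cover_power \<U> n \<subseteq> PiE {1..n} ` ({1..n} \<rightarrow>\<^sub>E \<U>)"
  proof
    fix V assume "V \<in> cover_power \<U> n"
    then obtain U where U: "V = PiE {1..n} U" "\<And>j. j \<in> {1..n} \<Longrightarrow> U j \<in> \<U>"
      unfolding cover_power_def by blast
    have "V = PiE {1..n} (restrict U {1..n})"
      unfolding U(1) by (rule PiE_cong) simp
    moreover have "restrict U {1..n} \<in> {1..n} \<rightarrow>\<^sub>E \<U>" using U(2) by simp
    ultimately show "V \<in> PiE {1..n} ` ({1..n} \<rightarrow>\<^sub>E \<U>)" by (rule image_eqI)
  qed
  show "finite (PiE {1..n} ` ({1..n} \<rightarrow>\<^sub>E \<U>))"
    by (intro finite_imageI finite_PiE finite_atLeastAtMost assms)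
qed

lemma cover_power_nonempty:
  assumes "\<U> \<noteq> {}" shows "cover_power \<U> n \<noteq> {}"
proof -
  obtain U where "U \<in> \<U>" using assms by blast
  then have "PiE {1..n} (\<lambda>_. U) \<in> cover_power \<U> n" unfolding cover_power_def by blast
  then show ?thesis by blast
qed

text \<open>In use, \<open>P\<close> indexes types of points of \<open>K\<close>, and
  \<open>c \<phi>\<close> lists the factors of one product set containing all points of type
  \<phi>.\<close>

lemma covering_number_cover_power_le:
  assumes P: "finite P" and c: "\<And>\<phi> j. \<phi> \<in> P \<Longrightarrow> j \<in> {1..n} \<Longrightarrow> c \<phi> j \<in> \<U>"
    and K: "\<And>x. x \<in> K \<Longrightarrow> \<exists>\<phi>\<in>P. x \<in> PiE {1..n} (c \<phi>)"
  shows "covering_number (cover_power \<U> n) K \<le> card P"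
proof -
  let ?W = "(\<lambda>\<phi>. PiE {1..n} (c \<phi>)) ` P"
  have "?W \<subseteq> cover_power \<U> n" unfolding cover_power_def using c by blast
  moreover have "finite ?W" using P by (rule finite_imageI)
  moreover have "K \<subseteq> \<Union>?W" using K by blast
  ultimately have "covering_number (cover_power \<U> n) K \<le> card ?W"
    unfolding covering_number_def by (intro Least_le exI[of _ ?W]) simp
  also have "\<dots> \<le> card P" by (rule card_image_le[OF P])
  finally show ?thesis .
qed

text \<open>One pair \<open>F\<close>, \<delta> bounds both infima, and the maximum over the finite
  nonempty power cover is attained at some \<open>V\<close>.\<close>

lemma cond_cover_entropy_le:
  assumes F: "finite F" "F \<noteq> {}" "F \<subseteq> carrier G" and \<delta>: "\<delta> > 0"
    and \<U>2: "finite \<U>2" "\<U>2 \<noteq> {}"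
    and ev: "\<forall>\<^sub>F i in sequentially. 0 < d i \<and> (\<forall>V\<in>cover_power \<U>2 (d i).
      real (covering_number (cover_power \<U>1 (d i)) (approx_orbits act X (d i) F \<delta> (\<sigma> i) \<inter> V))
        \<le> exp (real (d i) * c))"
  shows "cond_cover_entropy G d \<sigma> act X \<U>1 \<U>2 \<le> ereal c"
proof -
  define N where "N i V =
    covering_number (cover_power \<U>1 (d i)) (approx_orbits act X (d i) F \<delta> (\<sigma> i) \<inter> V)" for i V
  have "\<forall>\<^sub>F i in sequentially.
    ereal (1 / real (d i)) * elog (Max (N i ` cover_power \<U>2 (d i))) \<le> ereal c"
    using ev
  proof eventually_elim
    case (elim i)
    have "Max (N i ` cover_power \<U>2 (d i)) \<in> N i ` cover_power \<U>2 (d i)"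
      using finite_cover_power[OF \<U>2(1), of "d i"] cover_power_nonempty[OF \<U>2(2), of "d i"]
      by (intro Max_in) auto
    then have "real (Max (N i ` cover_power \<U>2 (d i))) \<le> exp (real (d i) * c)"
      using elim unfolding N_def by auto
    then have "ereal (1 / real (d i)) * elog (Max (N i ` cover_power \<U>2 (d i)))
        \<le> ereal (1 / real (d i)) * ereal (real (d i) * c)"
      by (intro ereal_mult_left_mono elog_le) auto
    also have "\<dots> = ereal c" using elim by simp
    finally show ?case .
  qed
  then have "limsup (\<lambda>i. ereal (1 / real (d i)) * elog (Max (N i ` cover_power \<U>2 (d i)))) \<le> ereal c"
    by (rule Limsup_bounded)
  then show ?thesis
    unfolding cond_cover_entropy_def N_def using F \<delta>
    by (intro INF_lower2[of F] INF_lower2[of \<delta>]) auto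
qed

text \<open>Each of the three contributions is kept below \<open>\<epsilon> / 3\<close>. The order
  of choice matters: \<eta> must absorb \<open>- ln t\<close>, so \<open>t\<close> comes
  first.\<close>

lemma entropy_constants:
  fixes L \<epsilon> :: real
  assumes "L \<ge> 0" "\<epsilon> > 0"
  obtains t \<eta> :: real and M :: nat where "0 < t" "t \<le> 1" "\<eta> > 0" "M > 0"
    "t - \<eta> * ln t + (1 / real M + \<eta>) * L \<le> \<epsilon>"
proof -
  define t where "t = min 1 (\<epsilon> / 3)"
  have t: "0 < t" "t \<le> 1" "t \<le> \<epsilon> / 3" using assms by (auto simp: t_def)
  \<comment> \<open>The summand 1 keeps the denominator positive when \<open>L = 0\<close> and
    \<open>t = 1\<close>.\<close>
  define \<eta> where "\<eta> = \<epsilon> / (3 * (L - ln t + 1))"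
  have pos: "L - ln t \<ge> 0" using t(1,2) assms(1) ln_le_zero_iff[of t] by linarith
  have \<eta>: "\<eta> > 0" using pos assms by (simp add: \<eta>_def)
  have "\<eta> * (L - ln t) \<le> \<eta> * (L - ln t + 1)" using \<eta> by simp
  also have "\<dots> = \<epsilon> / 3" using pos by (simp add: \<eta>_def field_simps)
  finally have 1: "\<eta> * (L - ln t) \<le> \<epsilon> / 3" .
  obtain M0 :: nat where "real M0 > 3 * L / \<epsilon>" using reals_Archimedean2 by blast
  moreover define M where "M = Suc M0"
  ultimately have "real M \<ge> 3 * L / \<epsilon>" "M > 0" by auto
  then have "L / real M \<le> \<epsilon> / 3" using assms by (simp add: field_simps)
  moreover have "t - \<eta> * ln t + (1 / real M + \<eta>) * L = t + L / real M + \<eta> * (L - ln t)"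
    by (simp add: algebra_simps)
  ultimately have "t - \<eta> * ln t + (1 / real M + \<eta>) * L \<le> \<epsilon>"
    using t(3) 1 by linarith
  then show ?thesis using that t \<eta> \<open>M > 0\<close> by blast
qed

section \<open>Sofic approximations and approximate orbits\<close>

lemma sofic_dimension_pos:
  assumes "sofic_approximation G d \<sigma>"
  shows "\<forall>\<^sub>F i in sequentially. 0 < d i"
proof -
  have "filterlim d at_top sequentially" using assms by (simp add: sofic_approximation_def)
  then have "\<forall>\<^sub>F i in sequentially. 1 \<le> d i" unfolding filterlim_at_top by (rule spec)
  then show ?thesis by (rule eventually_mono) simp
qed

lemma sofic_maps_into:
  assumes "sofic_approximation G d \<sigma>" "g \<in> carrier G" "a \<in> {1..d i}"
  shows "\<sigma> i g a \<in> {1..d i}"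
proof -
  have "\<sigma> i g permutes {1..d i}" using assms(1,2) by (simp add: sofic_approximation_def)
  then show ?thesis using assms(3) permutes_in_image by metis
qed

text \<open>Injectivity fails at \<open>a\<close> only if two distinct elements of \<open>F\<close>
  collide there. Each of the finitely many pairs eventually collides on a small proportion of
  places.\<close>

lemma sofic_eventually_free:
  assumes sofic: "sofic_approximation G d \<sigma>" and F: "finite F" "F \<subseteq> carrier G" and \<eta>: "\<eta> > 0"
  shows "\<forall>\<^sub>F i in sequentially.
    real (card {a \<in> {1..d i}. \<not> inj_on (\<lambda>s. \<sigma> i s a) F}) \<le> \<eta> * real (d i)"
proof -
  define R where "R = {p \<in> F \<times> F. fst p \<noteq> snd p}"
  have R: "finite R" using F by (simp add: R_def)
  \<comment> \<open>The allowance \<eta> is shared among the pairs; adding 1 keeps the quotient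
    meaningful when \<open>R\<close> is empty.\<close>
  define \<eta>' where "\<eta>' = \<eta> / (real (card R) + 1)"
  have \<eta>': "\<eta>' > 0" using \<eta> by (simp add: \<eta>'_def)
  define E where "E i p = {a \<in> {1..d i}. \<sigma> i (fst p) a = \<sigma> i (snd p) a}" for i p
  have "\<forall>\<^sub>F i in sequentially. 1 - \<eta>' <
      real (card {a \<in> {1..d i}. \<sigma> i (fst p) a \<noteq> \<sigma> i (snd p) a}) / real (d i)" if "p \<in> R" for p
  proof (rule order_tendstoD)
    show "(\<lambda>i. real (card {a \<in> {1..d i}. \<sigma> i (fst p) a \<noteq> \<sigma> i (snd p) a}) / real (d i)) \<longlonglongrightarrow> 1"
    proof -
      have "fst p \<in> carrier G" "snd p \<in> carrier G" "fst p \<noteq> snd p"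
        using that F(2) by (auto simp: R_def)
      then show ?thesis using sofic by (simp add: sofic_approximation_def)
    qed
  qed (use \<eta>' in simp)
  then have "\<forall>\<^sub>F i in sequentially. \<forall>p\<in>R. 1 - \<eta>' <
      real (card {a \<in> {1..d i}. \<sigma> i (fst p) a \<noteq> \<sigma> i (snd p) a}) / real (d i)"
    using R by (simp add: eventually_ball_finite)
  then show ?thesis using sofic_dimension_pos[OF sofic]
  proof eventually_elim
    case (elim i)
    have E: "real (card (E i p)) \<le> \<eta>' * real (d i)" if "p \<in> R" for p
    proof -
      let ?N = "{a \<in> {1..d i}. \<sigma> i (fst p) a \<noteq> \<sigma> i (snd p) a}"
      have "E i p \<union> ?N = {1..d i}" unfolding E_def by blast
      moreover have "card (E i p \<union> ?N) = card (E i p) + card ?N"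
        by (rule card_Un_disjoint) (auto simp: E_def)
      ultimately have "real (card (E i p)) + real (card ?N) = real (d i)" by simp
      moreover have "(1 - \<eta>') * real (d i) < real (card ?N)"
        using elim that by (simp add: pos_less_divide_eq)
      ultimately show ?thesis by (simp add: algebra_simps)
    qed
    have "{a \<in> {1..d i}. \<not> inj_on (\<lambda>s. \<sigma> i s a) F} \<subseteq> (\<Union>p\<in>R. E i p)"
      by (fastforce simp: inj_on_def R_def E_def)
    then have "card {a \<in> {1..d i}. \<not> inj_on (\<lambda>s. \<sigma> i s a) F} \<le> card (\<Union>p\<in>R. E i p)"
      using R by (intro card_mono finite_UN_I) (auto simp: E_def)
    also have "\<dots> \<le> (\<Sum>p\<in>R. card (E i p))" by (rule card_UN_le[OF R])
    finally have "real (card {a \<in> {1..d i}. \<not> inj_on (\<lambda>s. \<sigma> i s a) F}) \<le> (\<Sum>p\<in>R. real (card (E i p)))"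
      by (metis of_nat_le_iff of_nat_sum)
    also have "\<dots> \<le> real (card R) * (\<eta>' * real (d i))"
      using sum_mono[of R "\<lambda>p. real (card (E i p))" "\<lambda>_. \<eta>' * real (d i)"] E by simp
    also have "\<dots> \<le> (real (card R) + 1) * (\<eta>' * real (d i))"
      using \<eta>' by (intro mult_right_mono) auto
    also have "\<dots> = \<eta> * real (d i)" by (simp add: \<eta>'_def)
    finally show ?case .
  qed
qed

text \<open>Markov's inequality for the squared distances, whose mean over the places is at most the
  square of \<delta> by the definition of approximate orbits.\<close>

lemma approx_orbits_card_far_le:
  assumes x: "x \<in> approx_orbits act X n F \<delta> \<tau>" and F: "finite F" "s \<in> F" and "n > 0" "r > 0"
  shows "real (card {j \<in> {1..n}. \<not> mdist X (act s (x j)) (x (\<tau> s j)) < r}) * r\<^sup>2 \<le> \<delta>\<^sup>2 * real n"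
proof -
  let ?m = "\<lambda>j. mdist X (act s (x j)) (x (\<tau> s j))"
  let ?B = "{j \<in> {1..n}. \<not> ?m j < r}"
  let ?h = "\<lambda>s. sqrt (\<Sum>j=1..n. 1 / real n * (mdist X (act s (x j)) (x (\<tau> s j)))\<^sup>2)"
  have max: "Max (?h ` F) < \<delta>" using x by (simp add: approx_orbits_def)
  have lt: "sqrt (\<Sum>j=1..n. 1 / real n * (?m j)\<^sup>2) < \<delta>"
    by (rule le_less_trans[OF Max_ge max]) (use F in auto)
  have nonneg: "(\<Sum>j=1..n. 1 / real n * (?m j)\<^sup>2) \<ge> 0" by (intro sum_nonneg) simp
  have "(sqrt (\<Sum>j=1..n. 1 / real n * (?m j)\<^sup>2))\<^sup>2 \<le> \<delta>\<^sup>2"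
    using lt nonneg by (intro power_mono) auto
  then have "(\<Sum>j=1..n. 1 / real n * (?m j)\<^sup>2) \<le> \<delta>\<^sup>2" using nonneg by simp
  then have sum: "(\<Sum>j=1..n. (?m j)\<^sup>2) \<le> \<delta>\<^sup>2 * real n"
    using \<open>n > 0\<close> by (simp add: pos_divide_le_eq flip: sum_divide_distrib)
  have "real (card ?B) * r\<^sup>2 = (\<Sum>j\<in>?B. r\<^sup>2)" by simp
  also have "\<dots> \<le> (\<Sum>j\<in>?B. (?m j)\<^sup>2)"
    using \<open>r > 0\<close> by (intro sum_mono power_mono) auto
  also have "\<dots> \<le> (\<Sum>j=1..n. (?m j)\<^sup>2)" by (intro sum_mono2) auto
  finally show ?thesis using sum by simp
qed

section \<open>The two cases of h-expansiveness\<close>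

context metric_coset_tree
begin

text \<open>A finite metric space is discrete, so the singletons form an open cover. A product of
  singletons lies in one product of members of \<open>\<U>1\<close>, so every covering number is at
  most 1.\<close>

lemma h_expansive_finite:
  assumes sofic: "sofic_approximation G d \<sigma>" and fin: "finite (tree_boundary G H)"
  shows "h_expansive G d \<sigma> (profinite_action G) X"
proof -
  define \<U> where "\<U> = (\<lambda>x. {x}) ` tree_boundary G H"
  have "Hausdorff_space (mtopology_of X)"
    unfolding mtopology_of_def by (rule Metric_space.Hausdorff_space_mtopology[OF Metric_space_mspace_mdist])
  then have "mtopology_of X = discrete_topology (mspace X)"
    using fin by (intro finite_topspace_imp_discrete_topology) (auto simp: mspace_X)
  then have \<U>: "\<U> \<in> finite_open_covers X"
    using fin by (auto simp: finite_open_covers_def \<U>_def mspace_X)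
  have "cond_cover_entropy G d \<sigma> (profinite_action G) X \<U>1 \<U> \<le> ereal 0"
    if \<U>1: "\<U>1 \<in> finite_open_covers X" for \<U>1
  proof (rule cond_cover_entropy_le[where F = "{\<one>}" and \<delta> = 1])
    show "\<U> \<noteq> {}" using boundary_nonempty by (simp add: \<U>_def)
    show "finite \<U>" using fin by (simp add: \<U>_def)
    have le1: "covering_number (cover_power \<U>1 n) (K \<inter> V) \<le> 1"
      if "V \<in> cover_power \<U> n" for n K V
    proof -
      obtain U where U: "V = PiE {1..n} U" "\<And>j. j \<in> {1..n} \<Longrightarrow> U j \<in> \<U>"
        using \<open>V \<in> cover_power \<U> n\<close> unfolding cover_power_def by blast
      have "\<forall>j\<in>{1..n}. \<exists>W\<in>\<U>1. U j \<subseteq> W"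
      proof
        fix j assume "j \<in> {1..n}"
        then obtain y where "U j = {y}" "y \<in> mspace X"
          using U(2) unfolding \<U>_def mspace_X by blast
        moreover have "\<Union>\<U>1 = mspace X" using \<U>1 by (simp add: finite_open_covers_def)
        ultimately show "\<exists>W\<in>\<U>1. U j \<subseteq> W" by auto
      qed
      then obtain W where W: "\<And>j. j \<in> {1..n} \<Longrightarrow> W j \<in> \<U>1" "\<And>j. j \<in> {1..n} \<Longrightarrow> U j \<subseteq> W j"
        by metis
      have "V \<subseteq> PiE {1..n} W" unfolding U(1) using W(2) by (rule PiE_mono)
      then have "covering_number (cover_power \<U>1 n) (K \<inter> V) \<le> card {()}"
        using W(1) by (intro covering_number_cover_power_le[where c = "\<lambda>_. W"]) auto
      then show ?thesis by simp
    qed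
    then show "\<forall>\<^sub>F i in sequentially. 0 < d i \<and> (\<forall>V\<in>cover_power \<U> (d i).
      real (covering_number (cover_power \<U>1 (d i))
        (approx_orbits (profinite_action G) X (d i) {\<one>} 1 (\<sigma> i) \<inter> V)) \<le> exp (real (d i) * 0))"
      using sofic_dimension_pos[OF sofic] by (auto elim!: eventually_mono)
  qed auto
  then have "cond_entropy G d \<sigma> (profinite_action G) X \<U> \<le> 0"
    unfolding cond_entropy_def zero_ereal_def by (auto intro: SUP_least)
  then show ?thesis unfolding h_expansive_def using \<U> by blast
qed

text \<open>The trivial cover suffices because the number of itineraries grows subexponentially.
  Infinitude of the group supplies sets \<open>F\<close> of any prescribed size, which makes the
  packing term small.\<close>

lemma h_expansive_infinite:
  assumes sofic: "sofic_approximation G d \<sigma>" and inf: "infinite (carrier G)"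
  shows "h_expansive G d \<sigma> (profinite_action G) X"
proof -
  have \<U>: "{mspace X} \<in> finite_open_covers X"
    using openin_topspace[of "mtopology_of X"] by (simp add: finite_open_covers_def)
  have "cond_cover_entropy G d \<sigma> (profinite_action G) X \<U>1 {mspace X} \<le> 0"
    if \<U>1: "\<U>1 \<in> finite_open_covers X" for \<U>1
  proof (rule ereal_le_epsilon2)
    fix \<epsilon> :: real assume \<epsilon>: "0 < \<epsilon>"
    have "\<exists>N. \<forall>z\<in>tree_boundary G H. \<exists>U\<in>\<U>1. boundary_cylinder G H N (z N) \<subseteq> U"
    proof (rule boundary_uniform_level[of "\<lambda>S. \<exists>U\<in>\<U>1. S \<subseteq> U"])
      fix z assume z: "z \<in> tree_boundary G H"
      then obtain U where U: "U \<in> \<U>1" "z \<in> U"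
        using \<U>1 unfolding finite_open_covers_def mspace_X by blast
      then have "openin (boundary_topology G H) U"
        using \<U>1 unfolding finite_open_covers_def mtopology_X by blast
      from boundary_open_cylinder[OF this U(2) z] U(1)
      show "\<exists>n. \<exists>U\<in>\<U>1. boundary_cylinder G H n (z n) \<subseteq> U" by blast
    qed (meson order_trans)
    then obtain N where "\<forall>z\<in>tree_boundary G H. \<exists>U\<in>\<U>1. boundary_cylinder G H N (z N) \<subseteq> U" ..
    then have "\<forall>C\<in>(\<lambda>z. z N) ` tree_boundary G H. \<exists>U\<in>\<U>1. boundary_cylinder G H N C \<subseteq> U" by blast
    \<comment> \<open>The function \<open>u\<close> assigns to a level-\<open>N\<close> vertex a
      member of \<open>\<U>1\<close> containing its cylinder, so an itinerary names a member of the
      power cover.\<close>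
    from bchoice[OF this[unfolded Bex_def]] obtain u where u: "\<And>z. z \<in> tree_boundary G H \<Longrightarrow> u (z N) \<in> \<U>1"
      "\<And>z. z \<in> tree_boundary G H \<Longrightarrow> boundary_cylinder G H N (z N) \<subseteq> u (z N)"
      by blast
    obtain r where r: "r > 0"
      "\<And>x y. x \<in> tree_boundary G H \<Longrightarrow> y \<in> tree_boundary G H \<Longrightarrow> mdist X x y < r \<Longrightarrow> x N = y N"
      using cylinders_separated[of N] by meson
    define Q where "Q = lcosets (H N)"
    have Q: "finite Q" "Q \<noteq> {}"
      using finite_lcosets_H boundary_nonempty boundary_lcosets by (auto simp: Q_def)
    then have lnQ: "ln (real (card Q)) \<ge> 0" by (simp add: Suc_le_eq card_gt_0_iff)
    obtain t \<eta> :: real and M :: nat where const: "0 < t" "t \<le> 1" "\<eta> > 0" "M > 0"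
      "t - \<eta> * ln t + (1 / real M + \<eta>) * ln (real (card Q)) \<le> \<epsilon>"
      by (rule entropy_constants[OF lnQ \<epsilon>])
    obtain F where F: "finite F" "card F = M" "F \<subseteq> carrier G"
      using infinite_arbitrarily_large[OF inf] by meson
    then have "F \<noteq> {}" using const(4) by auto
    \<comment> \<open>Chosen so that the Markov bounds for the \<open>M\<close> elements of
      \<open>F\<close> add up to \<open>\<eta> / 2\<close> times the dimension. The other half is
      reserved for places where freeness fails.\<close>
    define \<delta> where "\<delta> = r * sqrt (\<eta> / (2 * real M))"
    have \<delta>: "\<delta> > 0" using r const by (simp add: \<delta>_def)
    have \<delta>2: "real M * \<delta>\<^sup>2 = r\<^sup>2 * (\<eta> / 2)"
      using const by (simp add: \<delta>_def power_mult_distrib)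
    have "cond_cover_entropy G d \<sigma> (profinite_action G) X \<U>1 {mspace X} \<le> ereal \<epsilon>"
    proof (rule cond_cover_entropy_le[OF F(1) \<open>F \<noteq> {}\<close> F(3) \<delta>])
      have "\<forall>\<^sub>F i in sequentially.
          real (card {a \<in> {1..d i}. \<not> inj_on (\<lambda>s. \<sigma> i s a) F}) \<le> \<eta> / 2 * real (d i)"
        using const(3) by (intro sofic_eventually_free[OF sofic F(1,3)]) simp
      then show "\<forall>\<^sub>F i in sequentially. 0 < d i \<and> (\<forall>V\<in>cover_power {mspace X} (d i).
        real (covering_number (cover_power \<U>1 (d i))
          (approx_orbits (profinite_action G) X (d i) F \<delta> (\<sigma> i) \<inter> V)) \<le> exp (real (d i) * \<epsilon>))"
        using sofic_dimension_pos[OF sofic]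
      proof eventually_elim
        case (elim i)
        define D where "D = {1..d i}"
        define K where "K = approx_orbits (profinite_action G) X (d i) F \<delta> (\<sigma> i)"
        have K: "x j \<in> tree_boundary G H" if "x \<in> K" "j \<in> D" for x j
          using that unfolding K_def approx_orbits_def D_def mspace_X by auto
        \<comment> \<open>The itinerary of a tuple: the level-\<open>N\<close> vertex visited at
          each place.\<close>
        define pat where "pat x = (\<lambda>j\<in>D. x j N)" for x :: "nat \<Rightarrow> nat \<Rightarrow> 'a set"
        have \<sigma>D: "\<sigma> i s a \<in> D" if "s \<in> F" "a \<in> D" for s a
          using sofic_maps_into[OF sofic] that F(3) unfolding D_def by blast
        have patQ: "pat ` K \<subseteq> D \<rightarrow>\<^sub>E Q"
          using K boundary_lcosets by (auto simp: pat_def Q_def)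
        have finP: "finite (pat ` K)"
          by (rule finite_subset[OF patQ]) (intro finite_PiE Q(1), simp add: D_def)
        have "real (card (pat ` K)) \<le> exp (real (card D) *
            (t - \<eta> * ln t + (1 / real (card F) + \<eta>) * ln (real (card Q))))"
        proof (rule card_almost_equivariant_maps_le[where act = "l_coset G" and \<tau> = "\<sigma> i"])
          fix \<phi> assume "\<phi> \<in> pat ` K"
          then obtain x where x: "x \<in> K" "\<phi> = pat x" by blast
          define B where "B s = {j \<in> {1..d i}.
              \<not> mdist X (profinite_action G s (x j)) (x (\<sigma> i s j)) < r}" for s
          define I where "I = {a \<in> D. \<not> inj_on (\<lambda>s. \<sigma> i s a) F}"
          define Bad where "Bad = {a \<in> D. \<not> (inj_on (\<lambda>s. \<sigma> i s a) F \<and> (\<forall>s\<in>F. \<phi> (\<sigma> i s a) = s <# \<phi> a))}"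
          \<comment> \<open>If freeness holds at \<open>a\<close> but the itinerary is not
            equivariant there, the two compared points differ at level \<open>N\<close>, hence are
            at least \<open>r\<close> apart.\<close>
          have "Bad \<subseteq> I \<union> (\<Union>s\<in>F. B s)"
          proof
            fix a
            assume a: "a \<in> Bad"
            show "a \<in> I \<union> (\<Union>s\<in>F. B s)"
            proof (cases "inj_on (\<lambda>s. \<sigma> i s a) F")
              case True
              then obtain s where s: "s \<in> F" "\<phi> (\<sigma> i s a) \<noteq> s <# \<phi> a" using a unfolding Bad_def by blast
              have aD: "a \<in> D" using a by (simp add: Bad_def)
              have "x (\<sigma> i s a) N \<noteq> profinite_action G s (x a) N"
                using s aD \<sigma>D[OF s(1) aD] by (simp add: x(2) pat_def profinite_action_def)
              moreover have "profinite_action G s (x a) \<in> tree_boundary G H"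
                using profinite_action_boundary K[OF x(1) aD] s(1) F(3) by blast
              ultimately have "\<not> mdist X (profinite_action G s (x a)) (x (\<sigma> i s a)) < r"
                using r(2) K[OF x(1) \<sigma>D[OF s(1) aD]] by metis
              then show ?thesis using s(1) aD by (auto simp: B_def D_def)
            qed (use a in \<open>simp add: I_def Bad_def\<close>)
          qed
          then have "card Bad \<le> card (I \<union> (\<Union>s\<in>F. B s))"
            using F(1) by (intro card_mono) (auto simp: I_def B_def D_def)
          also have "\<dots> \<le> card I + (\<Sum>s\<in>F. card (B s))"
            using card_Un_le[of I "\<Union>s\<in>F. B s"] card_UN_le[OF F(1), of B] by linarith
          finally have "real (card Bad) \<le> real (card I + (\<Sum>s\<in>F. card (B s)))"
            by (rule of_nat_mono)
          then have le: "real (card Bad) \<le> real (card I) + (\<Sum>s\<in>F. real (card (B s)))" by simp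
          have "(\<Sum>s\<in>F. real (card (B s))) * r\<^sup>2 = (\<Sum>s\<in>F. real (card (B s)) * r\<^sup>2)"
            by (rule sum_distrib_right)
          also have "\<dots> \<le> (\<Sum>s\<in>F. \<delta>\<^sup>2 * real (d i))"
            using x(1) F(1) elim(2) r(1) unfolding B_def K_def
            by (intro sum_mono approx_orbits_card_far_le) auto
          also have "\<dots> = (\<eta> / 2 * real (d i)) * r\<^sup>2"
            using \<delta>2 F(2) by (simp add: algebra_simps)
          finally have "(\<Sum>s\<in>F. real (card (B s))) \<le> \<eta> / 2 * real (d i)"
            using r(1) by (simp add: mult_le_cancel_right)
          moreover have "real (card I) \<le> \<eta> / 2 * real (d i)" using elim(1) by (simp add: I_def D_def)
          ultimately have "real (card Bad) \<le> \<eta> * real (card D)" using le by (simp add: D_def)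
          then show "real (card {a \<in> D. \<not> (inj_on (\<lambda>s. \<sigma> i s a) F \<and> (\<forall>s\<in>F. \<phi> (\<sigma> i s a) = s <# \<phi> a))})
              \<le> \<eta> * real (card D)"
            unfolding Bad_def .
        next
          show "inj_on (l_coset G s) Q" if "s \<in> F" for s
            unfolding Q_def using that F(3) by (intro inj_on_l_coset) blast
        qed (use Q F(1) \<open>F \<noteq> {}\<close> const(1,2) patQ \<sigma>D in \<open>simp_all add: D_def\<close>)
        also have "\<dots> \<le> exp (real (d i) * \<epsilon>)"
          using mult_left_mono[OF const(5), of "real (d i)"] by (simp add: D_def F(2))
        finally have cardP: "real (card (pat ` K)) \<le> exp (real (d i) * \<epsilon>)" .
        \<comment> \<open>All tuples with the same itinerary lie in the one product set named by
          \<open>u\<close>.\<close>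
        have cov: "covering_number (cover_power \<U>1 (d i)) (K \<inter> V) \<le> card (pat ` K)" for V
        proof (rule covering_number_cover_power_le[OF finP, where c = "\<lambda>\<phi> j. u (\<phi> j)"])
          show "u (\<phi> j) \<in> \<U>1" if "\<phi> \<in> pat ` K" "j \<in> {1..d i}" for \<phi> j
            using that K u(1) by (auto simp: pat_def D_def)
        next
          fix x assume x: "x \<in> K \<inter> V"
          have "x \<in> PiE {1..d i} (\<lambda>j. u (pat x j))"
          proof (rule PiE_I)
            fix j assume j: "j \<in> {1..d i}"
            then have "x j \<in> tree_boundary G H" using K x by (simp add: D_def)
            then show "x j \<in> u (pat x j)"
              using u(2)[of "x j"] j by (auto simp: pat_def D_def boundary_cylinder_def)
          next
            have "x \<in> {1..d i} \<rightarrow>\<^sub>E mspace X" using x by (simp add: K_def approx_orbits_def)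
            then show "x j = undefined" if "j \<notin> {1..d i}" for j
              using that by (rule PiE_arb)
          qed
          then show "\<exists>\<phi>\<in>pat ` K. x \<in> PiE {1..d i} (\<lambda>j. u (\<phi> j))" using x by blast
        qed
        have "real (covering_number (cover_power \<U>1 (d i)) (K \<inter> V)) \<le> exp (real (d i) * \<epsilon>)" for V
          by (rule order_trans[OF of_nat_mono[OF cov] cardP])
        then show ?case using elim(2) unfolding K_def by blast
      qed
    qed auto
    then show "cond_cover_entropy G d \<sigma> (profinite_action G) X \<U>1 {mspace X} \<le> 0 + ereal \<epsilon>"
      by simp
  qed
  then have "cond_entropy G d \<sigma> (profinite_action G) X {mspace X} \<le> 0"
    unfolding cond_entropy_def by (auto intro: SUP_least)
  then show ?thesis unfolding h_expansive_def using \<U> by blast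
qed

end

theorem proposition4p2:
  fixes G :: "('g, 'b) monoid_scheme"
    and d :: "nat \<Rightarrow> nat"
    and \<sigma> :: "nat \<Rightarrow> 'g \<Rightarrow> nat \<Rightarrow> nat"
    and H :: "nat \<Rightarrow> 'g set"
    and X :: "(nat \<Rightarrow> 'g set) metric"
  assumes "group G" and "countable (carrier G)"
    and "sofic_approximation G d \<sigma>"
    and "group_chain G H"
    and "mspace X = tree_boundary G H"
    and "mtopology_of X = boundary_topology G H"
  shows "h_expansive G d \<sigma> (profinite_action G) X \<and>
         (infinite (tree_boundary G H) \<longrightarrow> \<not> expansive G (profinite_action G) X)"
proof -
  interpret group G by fact
  interpret metric_coset_tree G H X by unfold_locales fact+
  \<comment> \<open>Split on whether the group is finite; if it is, the boundary is finite as
    well.\<close>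
  show ?thesis
    using assms(3) h_expansive_finite h_expansive_infinite finite_boundary not_expansive by blast
qed

end
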